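(* Let $\gamma\in\mathbb{R}$, let $A\in\mathbb{R}^{n\times n}_+$ have positive diagonal, let $p\in\mathbb{R}^n_+$, and let $E\colon(\mathbb{R}_+\setminus\{0\})^n\to\mathbb{R}_+$ be defined by $$E(\eta)=\prod_{i=1}^n\frac1{\eta_i}\Bigl(p_i+\sum_{j=1}^nA_{i,j}\eta_j\Bigr).$$ Then the optimization problem $$\min_{\xi>0}E(\xi)\quad\text{subject to}\quad\exp(\gamma)=\prod_{i=1}^n\xi_i$$ has a unique minimum point if and only if $A$ or $\left(\begin{smallmatrix}A&p\\ \mathbf{1}&1\end{smallmatrix}\right)$ is irreducible.
   Context: $\mathbb{R}_+$ is the set of nonnegative reals, and $\xi>0$ for $\xi\in\mathbb{R}^n$ is meant component-wise. $\mathbf{1}$ denotes the all-ones vector $(1,\dots,1)$ (here a row of length $n$, so that $\left(\begin{smallmatrix}A&p\\ \mathbf{1}&1\end{smallmatrix}\right)$ is an $(n+1)\times(n+1)$ matrix). A matrix $M\in\mathbb{R}^{k\times k}$ is irreducible if for any $r,s\in\{1,\dots,k\}$ with $r\ne s$ there exist distinct indices $i_1,\dots,i_m\in\{1,\dots,k\}$ with $i_1=r$, $i_m=s$ and $M_{i_l,i_{l+1}}>0$ for all $l\in\{1,\dots,m-1\}$. *)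

theory Defs
  imports "HOL-Analysis.Analysis"
begin

definition irreducible_matrix :: "real ^ 'k ^ 'k \<Rightarrow> bool" where
  "irreducible_matrix M \<longleftrightarrow>
     (\<forall>r s. r \<noteq> s \<longrightarrow>
        (\<exists>is. is \<noteq> [] \<and> distinct is \<and> hd is = r \<and> last is = s \<and>
           (\<forall>l. Suc l < length is \<longrightarrow> M $ (is ! l) $ (is ! Suc l) > 0)))"

(* The (n+1) x (n+1) matrix with rows (A, p) and (1, ..., 1, 1); the additional index is Inr (). *)
definition bordered_matrix :: "real ^ 'n ^ 'n \<Rightarrow> real ^ 'n \<Rightarrow> real ^ ('n + unit) ^ ('n + unit)" where
  "bordered_matrix A p =
     (\<chi> r c. case r of
         Inl i \<Rightarrow> (case c of Inl j \<Rightarrow> A $ i $ j | Inr _ \<Rightarrow> p $ i)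
       | Inr _ \<Rightarrow> 1)"

(* Only meant for componentwise positive eta. *)
definition E :: "real ^ 'n ^ 'n \<Rightarrow> real ^ 'n \<Rightarrow> real ^ 'n \<Rightarrow> real" where
  "E A p \<eta> = (\<Prod>i\<in>UNIV. 1 / \<eta> $ i * (p $ i + (\<Sum>j\<in>UNIV. A $ i $ j * \<eta> $ j)))"

end

theory Submission
  imports Defs
begin

text \<open>
  Call a nonempty proper index set blocking if \<open>p\<close> vanishes on it and no positive entry of \<open>A\<close>
  leads out of it. Irreducibility of \<open>A\<close> or of the bordered matrix means that there is no
  blocking set, because the new index reaches everything and is reached exactly from the
  indices that lead to the support of \<open>p\<close>.
  In logarithmic coordinates the objective is a sum of log-sum-exp functions minus a constant on
  the constraint hyperplane. If there is no blocking set, then sublevel sets are compact, since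
  the positive diagonal bounds each factor and hence each ratio along an edge. Two distinct
  minimum points would give equality in the Cauchy-Schwarz inequality of each factor at their
  geometric mean, and the indices where their ratio is minimal would form a blocking set.
  Conversely, shrinking the coordinates in a blocking set, and enlarging the others
  to preserve the product, does not increase the objective.
\<close>

section \<open>Irreducibility and blocking sets\<close>

definition positive_graph :: "real ^ 'k ^ 'k \<Rightarrow> ('k \<times> 'k) set" where
  "positive_graph M = {(i, j). 0 < M $ i $ j}"

text \<open>Irreducibility asks for distinct indices, so walks have to be made simple: if the new
  first vertex already lies on the path, everything before that occurrence is dropped.\<close>

lemma rtrancl_imp_distinct_path:
  assumes "(r, s) \<in> R\<^sup>*"
  shows "\<exists>xs. xs \<noteq> [] \<and> distinct xs \<and> hd xs = r \<and> last xs = s \<and>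
           successively (\<lambda>x y. (x, y) \<in> R) xs"
  using assms
proof (induction rule: converse_rtrancl_induct)
  case base
  show ?case by (rule exI[of _ "[s]"]) simp
next
  case (step x y)
  then obtain xs where xs: "xs \<noteq> []" "distinct xs" "hd xs = y" "last xs = s"
    "successively (\<lambda>x y. (x, y) \<in> R) xs" by blast
  show ?case
  proof (cases "x \<in> set xs")
    case True
    then obtain us vs where "xs = us @ x # vs" by (meson split_list)
    with xs show ?thesis
      by (intro exI[of _ "x # vs"]) (auto simp: successively_append_iff)
  next
    case False
    with xs step.hyps(1) show ?thesis
      by (intro exI[of _ "x # xs"]) (auto simp: successively_Cons)
  qed
qed

lemma successively_imp_rtrancl:
  assumes "xs \<noteq> []" "successively (\<lambda>x y. (x, y) \<in> R) xs"
  shows "(hd xs, last xs) \<in> R\<^sup>*"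
  using assms
proof (induction xs)
  case (Cons x xs)
  then show ?case
    by (cases "xs = []") (auto simp: successively_Cons intro: converse_rtrancl_into_rtrancl)
qed simp

text \<open>Replaces index lists by reachability, which can be argued with closed sets; reflexivity
  supplies the case \<open>r = s\<close>.\<close>

lemma irreducible_matrix_iff_rtrancl:
  "irreducible_matrix M \<longleftrightarrow> (\<forall>r s. (r, s) \<in> (positive_graph M)\<^sup>*)"
proof
  assume irr: "irreducible_matrix M"
  have "(r, s) \<in> (positive_graph M)\<^sup>*" if "r \<noteq> s" for r s
  proof -
    from irr that obtain xs where "xs \<noteq> []" "hd xs = r" "last xs = s"
      "\<forall>l. Suc l < length xs \<longrightarrow> 0 < M $ (xs ! l) $ (xs ! Suc l)"
      unfolding irreducible_matrix_def by blast
    with successively_imp_rtrancl[of xs "positive_graph M"] show ?thesis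
      by (auto simp: successively_conv_nth positive_graph_def)
  qed
  then show "\<forall>r s. (r, s) \<in> (positive_graph M)\<^sup>*" by (metis rtrancl.rtrancl_refl)
next
  assume reach: "\<forall>r s. (r, s) \<in> (positive_graph M)\<^sup>*"
  show "irreducible_matrix M"
    unfolding irreducible_matrix_def
  proof (intro allI impI)
    fix r s :: 'a
    from rtrancl_imp_distinct_path[OF reach[rule_format, of r s]]
    show "\<exists>is. is \<noteq> [] \<and> distinct is \<and> hd is = r \<and> last is = s \<and>
            (\<forall>l. Suc l < length is \<longrightarrow> M $ (is ! l) $ (is ! Suc l) > 0)"
      by (auto simp: successively_conv_nth positive_graph_def)
  qed
qed

text \<open>For nonnegative \<open>A\<close>, the rows indexed by such a set are homogeneous linear
  in the coordinates of the set alone, which is why these coordinates can be rescaled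
  together.\<close>

definition blocking_set :: "real ^ 'n ^ 'n \<Rightarrow> real ^ 'n \<Rightarrow> 'n set \<Rightarrow> bool" where
  "blocking_set A p R \<longleftrightarrow> R \<noteq> {} \<and> R \<noteq> UNIV \<and>
     (\<forall>i\<in>R. p $ i = 0 \<and> (\<forall>j. 0 < A $ i $ j \<longrightarrow> j \<in> R))"

lemma rtrancl_closed_set:
  assumes "(i, j) \<in> r\<^sup>*" "i \<in> R" "\<And>x y. (x, y) \<in> r \<Longrightarrow> x \<in> R \<Longrightarrow> y \<in> R"
  shows "j \<in> R"
  using assms by (induction rule: rtrancl_induct) auto

lemma rtrancl_bordered_Inl:
  assumes "(i, j) \<in> (positive_graph A)\<^sup>*"
  shows "(Inl i, Inl j) \<in> (positive_graph (bordered_matrix A p))\<^sup>*"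
  using assms
proof (induction rule: rtrancl_induct)
  case (step y z)
  then have "(Inl y, Inl z) \<in> positive_graph (bordered_matrix A p)"
    by (simp add: positive_graph_def bordered_matrix_def)
  with step.IH show ?case by (rule rtrancl_into_rtrancl)
qed simp

text \<open>A blocking set traps every walk that starts in it, in both graphs. Conversely, the
  indices reachable from a given one form a closed set, which blocks as soon as it is proper and
  \<open>p\<close> vanishes on it.\<close>

lemma irreducible_iff_no_blocking_set:
  fixes A :: "real ^ 'n ^ 'n"
  assumes p: "\<And>i. 0 \<le> p $ i"
  shows "irreducible_matrix A \<or> irreducible_matrix (bordered_matrix A p)
    \<longleftrightarrow> (\<nexists>R. blocking_set A p R)"
proof
  let ?B = "positive_graph (bordered_matrix A p)"
  show "\<nexists>R. blocking_set A p R"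
    if "irreducible_matrix A \<or> irreducible_matrix (bordered_matrix A p)"
  proof
    assume "\<exists>R. blocking_set A p R"
    then obtain R r s where R: "blocking_set A p R" and rs: "r \<in> R" "s \<notin> R"
      unfolding blocking_set_def by blast
    have "y \<in> R" if "(x, y) \<in> positive_graph A" "x \<in> R" for x y
      using R that by (auto simp: blocking_set_def positive_graph_def)
    with rs have "\<not> irreducible_matrix A"
      using rtrancl_closed_set[of r s "positive_graph A" R]
      by (auto simp: irreducible_matrix_iff_rtrancl)
    \<comment> \<open>An edge from \<open>Inl i\<close> to the new index needs a positive entry of
      \<open>p\<close>, and \<open>p\<close> vanishes on \<open>R\<close>.\<close>
    moreover have "y \<in> Inl ` R" if "(x, y) \<in> ?B" "x \<in> Inl ` R" for x y
      using R that
      by (auto simp: blocking_set_def positive_graph_def bordered_matrix_def split: sum.splits)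
    with rs have "\<not> irreducible_matrix (bordered_matrix A p)"
      using rtrancl_closed_set[of "Inl r" "Inr ()" ?B "Inl ` R"]
      by (auto simp: irreducible_matrix_iff_rtrancl)
    ultimately show False using that by blast
  qed
  show "irreducible_matrix A \<or> irreducible_matrix (bordered_matrix A p)"
    if no: "\<nexists>R. blocking_set A p R"
  proof (rule ccontr)
    assume "\<not> ?thesis"
    then have nA: "\<not> irreducible_matrix A" and nB: "\<not> irreducible_matrix (bordered_matrix A p)"
      by auto
    have closed: "y \<in> (positive_graph A)\<^sup>* `` {r}"
      if "x \<in> (positive_graph A)\<^sup>* `` {r}" "0 < A $ x $ y" for r x y
      using that by (auto simp: positive_graph_def intro: rtrancl_into_rtrancl)
    have refl: "r \<in> (positive_graph A)\<^sup>* `` {r}" for r by simp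
    \<comment> \<open>Otherwise every index leads to the support of \<open>p\<close>, hence to the
      new index, which has an edge to everything; the bordered matrix would be irreducible.\<close>
    have "\<exists>i. \<forall>k. (i, k) \<in> (positive_graph A)\<^sup>* \<longrightarrow> p $ k = 0"
    proof (rule ccontr)
      assume "\<not> ?thesis"
      then have ex: "\<exists>k. (i, k) \<in> (positive_graph A)\<^sup>* \<and> 0 < p $ k" for i
        using p by (metis order_le_less)
      have to_border: "(x, Inr ()) \<in> ?B\<^sup>*" for x
      proof (cases x)
        case (Inl i)
        obtain k where k: "(i, k) \<in> (positive_graph A)\<^sup>*" "0 < p $ k" using ex by blast
        from k(2) have "(Inl k, Inr ()) \<in> ?B"
          by (simp add: positive_graph_def bordered_matrix_def)
        with rtrancl_bordered_Inl[OF k(1)] Inl show ?thesis by (auto intro: rtrancl_into_rtrancl)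
      qed simp
      have "(Inr (), y) \<in> ?B" for y
        by (simp add: positive_graph_def bordered_matrix_def)
      with to_border have "(x, y) \<in> ?B\<^sup>*" for x y by (meson rtrancl_into_rtrancl)
      with nB show False by (simp add: irreducible_matrix_iff_rtrancl)
    qed
    then obtain i where i: "\<And>k. (i, k) \<in> (positive_graph A)\<^sup>* \<Longrightarrow> p $ k = 0" by blast
    show False
    proof (cases "(positive_graph A)\<^sup>* `` {i} = UNIV")
      case True
      \<comment> \<open>Here \<open>p\<close> vanishes identically, so any proper reachable set
        blocks; a pair violating irreducibility of \<open>A\<close> supplies one.\<close>
      with i have p0: "p $ k = 0" for k by blast
      from nA obtain r s where rs: "(r, s) \<notin> (positive_graph A)\<^sup>*"
        by (auto simp: irreducible_matrix_iff_rtrancl)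
      have "blocking_set A p ((positive_graph A)\<^sup>* `` {r})"
        unfolding blocking_set_def using rs p0 closed[of _ r] refl[of r] by blast
      with no show False by blast
    next
      case False
      then have "blocking_set A p ((positive_graph A)\<^sup>* `` {i})"
        unfolding blocking_set_def using i closed[of _ i] refl[of i] by blast
      with no show False by blast
    qed
  qed
qed

section \<open>Weighted Cauchy-Schwarz with strictness\<close>

text \<open>Writes the defect in the Cauchy-Schwarz inequality as a weighted sum of squares, so that
  the inequality and its equality case can both be read off.\<close>

lemma lagrange_identity:
  fixes w u v :: "'a \<Rightarrow> real"
  shows "(\<Sum>j\<in>S. \<Sum>k\<in>S. w j * w k * (u j * v k - u k * v j)\<^sup>2)
    = 2 * ((\<Sum>j\<in>S. w j * (u j)\<^sup>2) * (\<Sum>j\<in>S. w j * (v j)\<^sup>2) - (\<Sum>j\<in>S. w j * (u j * v j))\<^sup>2)"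
proof -
  have "w j * w k * (u j * v k - u k * v j)\<^sup>2
      = (w j * (u j)\<^sup>2) * (w k * (v k)\<^sup>2) + (w j * (v j)\<^sup>2) * (w k * (u k)\<^sup>2)
        - 2 * ((w j * (u j * v j)) * (w k * (u k * v k)))" for j k
    by (simp add: power2_eq_square algebra_simps)
  then have "(\<Sum>j\<in>S. \<Sum>k\<in>S. w j * w k * (u j * v k - u k * v j)\<^sup>2)
    = (\<Sum>j\<in>S. \<Sum>k\<in>S. (w j * (u j)\<^sup>2) * (w k * (v k)\<^sup>2))
      + (\<Sum>j\<in>S. \<Sum>k\<in>S. (w j * (v j)\<^sup>2) * (w k * (u k)\<^sup>2))
      - 2 * (\<Sum>j\<in>S. \<Sum>k\<in>S. (w j * (u j * v j)) * (w k * (u k * v k)))"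
    by (simp only: sum.distrib sum_subtractf sum_distrib_left)
  then show ?thesis
    unfolding sum_product[symmetric] by (simp add: power2_eq_square)
qed

lemma weighted_Cauchy_Schwarz:
  fixes w u v :: "'a \<Rightarrow> real"
  assumes w: "\<And>j. j \<in> S \<Longrightarrow> 0 \<le> w j"
  shows "(\<Sum>j\<in>S. w j * (u j * v j))\<^sup>2 \<le> (\<Sum>j\<in>S. w j * (u j)\<^sup>2) * (\<Sum>j\<in>S. w j * (v j)\<^sup>2)"
proof -
  have "0 \<le> (\<Sum>j\<in>S. \<Sum>k\<in>S. w j * w k * (u j * v k - u k * v j)\<^sup>2)"
    using w by (intro sum_nonneg) auto
  then show ?thesis unfolding lagrange_identity by simp
qed

text \<open>Zero defect makes every nonnegative term of the double sum vanish, so \<open>u\<close>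
  and \<open>v\<close> are proportional on the support of \<open>w\<close>.\<close>

lemma weighted_Cauchy_Schwarz_eqD:
  fixes w u v :: "'a \<Rightarrow> real"
  assumes "finite S" and w: "\<And>j. j \<in> S \<Longrightarrow> 0 \<le> w j"
    and eq: "(\<Sum>j\<in>S. w j * (u j * v j))\<^sup>2 = (\<Sum>j\<in>S. w j * (u j)\<^sup>2) * (\<Sum>j\<in>S. w j * (v j)\<^sup>2)"
    and jk: "j \<in> S" "k \<in> S" "0 < w j" "0 < w k"
  shows "u j * v k = u k * v j"
proof -
  have "(\<Sum>j\<in>S. \<Sum>k\<in>S. w j * w k * (u j * v k - u k * v j)\<^sup>2) = 0"
    unfolding lagrange_identity using eq by simp
  then have "\<forall>j\<in>S. (\<Sum>k\<in>S. w j * w k * (u j * v k - u k * v j)\<^sup>2) = 0"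
    using w \<open>finite S\<close> by (subst (asm) sum_nonneg_eq_0_iff) (auto intro!: sum_nonneg)
  with jk(1) have "(\<Sum>k\<in>S. w j * w k * (u j * v k - u k * v j)\<^sup>2) = 0" by blast
  then have "\<forall>k\<in>S. w j * w k * (u j * v k - u k * v j)\<^sup>2 = 0"
    using w jk(1) \<open>finite S\<close> by (subst (asm) sum_nonneg_eq_0_iff) auto
  with jk show ?thesis by fastforce
qed

text \<open>Serves to turn a bound on a product into a bound on each factor.\<close>

lemma le_prod_of_ge_1:
  fixes f :: "'a \<Rightarrow> real"
  assumes "finite S" "i \<in> S" "\<And>j. j \<in> S \<Longrightarrow> 1 \<le> f j"
  shows "f i \<le> prod f S"
proof -
  have "1 \<le> prod f (S - {i})" using assms by (intro prod_ge_1) auto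
  moreover have "1 \<le> f i" using assms by blast
  ultimately have "f i * 1 \<le> f i * prod f (S - {i})" by (intro mult_left_mono) auto
  then show ?thesis using assms by (simp add: prod.remove)
qed

section \<open>The optimization problem\<close>

definition feasible :: "real \<Rightarrow> real ^ 'n \<Rightarrow> bool" where
  "feasible \<gamma> \<xi> \<longleftrightarrow> (\<forall>i. 0 < \<xi> $ i) \<and> exp \<gamma> = (\<Prod>i\<in>UNIV. \<xi> $ i)"

definition affine_row :: "real ^ 'n ^ 'n \<Rightarrow> real ^ 'n \<Rightarrow> 'n \<Rightarrow> real ^ 'n \<Rightarrow> real" where
  "affine_row A p i \<eta> = p $ i + (\<Sum>j\<in>UNIV. A $ i $ j * \<eta> $ j)"

lemma E_eq: "E A p \<eta> = (\<Prod>i\<in>UNIV. affine_row A p i \<eta>) / (\<Prod>i\<in>UNIV. \<eta> $ i)"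
  by (simp add: E_def affine_row_def prod_dividef)

text \<open>The constraint fixes the denominator, so minimizing \<open>E\<close> amounts to
  minimizing the product of the rows.\<close>

lemma E_eq_feasible:
  "feasible \<gamma> \<eta> \<Longrightarrow> E A p \<eta> = (\<Prod>i\<in>UNIV. affine_row A p i \<eta>) / exp \<gamma>"
  by (simp add: E_eq feasible_def)

locale positive_diagonal_system =
  fixes A :: "real ^ 'n ^ 'n" and p :: "real ^ 'n"
  assumes A_nonneg: "0 \<le> A $ i $ j"
    and A_diag: "0 < A $ i $ i"
    and p_nonneg: "0 \<le> p $ i"
begin

lemma entry_le_affine_row:
  assumes "\<And>k. 0 < \<eta> $ k"
  shows "A $ i $ j * \<eta> $ j \<le> affine_row A p i \<eta>"
proof -
  have "A $ i $ j * \<eta> $ j \<le> (\<Sum>j\<in>UNIV. A $ i $ j * \<eta> $ j)"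
    by (rule member_le_sum) (auto intro: mult_nonneg_nonneg A_nonneg less_imp_le[OF assms])
  with p_nonneg[of i] show ?thesis by (simp add: affine_row_def)
qed

lemma inhomogeneity_le_affine_row:
  assumes "\<And>k. 0 < \<eta> $ k"
  shows "p $ i \<le> affine_row A p i \<eta>"
  using assms by (simp add: affine_row_def sum_nonneg A_nonneg less_imp_le)

lemma affine_row_pos:
  assumes "\<And>k. 0 < \<eta> $ k"
  shows "0 < affine_row A p i \<eta>"
  using entry_le_affine_row[OF assms, of i i] mult_pos_pos[OF A_diag assms, of i i] by linarith

subsection \<open>Blocking sets destroy uniqueness\<close>

text \<open>Shrinking the coordinates in a blocking set leaves the factors there unchanged, and
  does not increase the others after compensating outside of the set.\<close>

lemma blocking_set_not_unique:
  assumes R: "blocking_set A p R" and \<xi>: "feasible \<gamma> \<xi>"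
  shows "\<exists>\<eta>. feasible \<gamma> \<eta> \<and> \<eta> \<noteq> \<xi> \<and> E A p \<eta> \<le> E A p \<xi>"
proof -
  \<comment> \<open>The exponents are crossed so that \<open>card R\<close> factors \<open>a\<close>
    and \<open>card (- R)\<close> factors \<open>b\<close> multiply to 1.\<close>
  define a :: real where "a = (1/2) ^ card (- R)"
  define b :: real where "b = 2 ^ card R"
  define c where "c i = (if i \<in> R then a else b)" for i
  define \<eta> :: "real ^ 'n" where "\<eta> = (\<chi> i. c i * \<xi> $ i)"
  have ne: "R \<noteq> {}" "- R \<noteq> {}" using R by (auto simp: blocking_set_def)
  then have card: "0 < card R" "0 < card (- R)" by (simp_all add: card_gt_0_iff)
  have a: "0 < a" "a < 1" unfolding a_def using card by (simp_all add: power_less_one_iff)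
  have b: "1 < b" unfolding b_def using card by (simp add: one_less_power)
  have c: "0 < c i" "c i \<le> b" for i using a b by (auto simp: c_def)
  have \<xi>pos: "0 < \<xi> $ i" for i using \<xi> by (simp add: feasible_def)
  have "(\<Prod>i\<in>UNIV. c i) = (\<Prod>i\<in>R. c i) * (\<Prod>i\<in>- R. c i)"
    by (subst prod.union_disjoint[symmetric]) (auto simp: Compl_partition)
  also have "\<dots> = a ^ card R * b ^ card (- R)" by (simp add: c_def)
  also have "\<dots> = ((1/2) * 2) ^ (card R * card (- R))"
    unfolding a_def b_def power_mult_distrib by (simp add: mult.commute flip: power_mult)
  finally have prod_c: "(\<Prod>i\<in>UNIV. c i) = 1" by simp
  have feas: "feasible \<gamma> \<eta>"
    using \<xi> c prod_c by (simp add: feasible_def \<eta>_def prod.distrib)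
  obtain i0 where "i0 \<in> R" using ne by blast
  then have "\<eta> $ i0 \<noteq> \<xi> $ i0" using a \<xi>pos[of i0] by (simp add: \<eta>_def c_def)
  then have "\<eta> \<noteq> \<xi>" by auto
  \<comment> \<open>Rows in \<open>R\<close> see only coordinates scaled by \<open>a\<close>. In the
    other rows every coordinate grows by at most \<open>b\<close>, and \<open>b > 1\<close> also
    covers the constant term.\<close>
  have row: "affine_row A p i \<eta> \<le> c i * affine_row A p i \<xi>" for i
  proof (cases "i \<in> R")
    case True
    have scaled: "A $ i $ j * \<eta> $ j = a * (A $ i $ j * \<xi> $ j)" for j
    proof (cases "j \<in> R")
      case False
      then have "A $ i $ j = 0"
        using R True A_nonneg[of i j] by (force simp: blocking_set_def)
      then show ?thesis by simp
    qed (simp add: \<eta>_def c_def)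
    have "p $ i = 0" using True R by (simp add: blocking_set_def)
    moreover have "(\<Sum>j\<in>UNIV. A $ i $ j * \<eta> $ j) = a * (\<Sum>j\<in>UNIV. A $ i $ j * \<xi> $ j)"
      unfolding sum_distrib_left by (intro sum.cong refl scaled)
    ultimately show ?thesis using True by (simp add: affine_row_def c_def)
  next
    case False
    have "A $ i $ j * \<eta> $ j \<le> b * (A $ i $ j * \<xi> $ j)" for j
      using mult_right_mono[OF c(2)[of j], of "A $ i $ j * \<xi> $ j"] A_nonneg[of i j] \<xi>pos[of j]
      by (simp add: \<eta>_def algebra_simps)
    then have "(\<Sum>j\<in>UNIV. A $ i $ j * \<eta> $ j) \<le> b * (\<Sum>j\<in>UNIV. A $ i $ j * \<xi> $ j)"
      by (simp add: sum_distrib_left sum_mono)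
    moreover have "p $ i \<le> b * p $ i" using b p_nonneg[of i] by (simp add: mult_le_cancel_right1)
    ultimately show ?thesis using False by (simp add: affine_row_def c_def distrib_left)
  qed
  have "0 < \<eta> $ k" for k using feas by (simp add: feasible_def)
  then have "(\<Prod>i\<in>UNIV. affine_row A p i \<eta>) \<le> (\<Prod>i\<in>UNIV. c i * affine_row A p i \<xi>)"
    using row by (intro prod_mono) (auto intro: less_imp_le affine_row_pos)
  also have "\<dots> = (\<Prod>i\<in>UNIV. affine_row A p i \<xi>)" by (simp add: prod.distrib prod_c)
  finally have "E A p \<eta> \<le> E A p \<xi>"
    unfolding E_eq_feasible[OF feas] E_eq_feasible[OF \<xi>] by (simp add: divide_right_mono)
  with feas \<open>\<eta> \<noteq> \<xi>\<close> show ?thesis by blast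
qed

subsection \<open>Uniqueness\<close>

text \<open>The inhomogeneity acts as an additional coordinate whose variable is fixed to 1.\<close>

lemma affine_row_option:
  "affine_row A p i \<eta> = (\<Sum>x\<in>UNIV. (case x of None \<Rightarrow> p $ i | Some j \<Rightarrow> A $ i $ j)
      * (case x of None \<Rightarrow> 1 | Some j \<Rightarrow> \<eta> $ j))"
  by (simp add: affine_row_def UNIV_option_conv sum.reindex)

text \<open>This is midpoint convexity of log-sum-exp, obtained from Cauchy-Schwarz for vectors of
  square roots weighted by the coefficients of the row. Equality means proportionality on the
  support of the row.\<close>

lemma affine_row_geometric_mean:
  assumes \<xi>: "\<And>i. 0 < \<xi> $ i" and \<eta>: "\<And>i. 0 < \<eta> $ i"
  defines "\<zeta> \<equiv> \<chi> i. sqrt (\<xi> $ i * \<eta> $ i)"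
  shows "(affine_row A p i \<zeta>)\<^sup>2 \<le> affine_row A p i \<xi> * affine_row A p i \<eta>" (is ?le)
    and "(affine_row A p i \<zeta>)\<^sup>2 = affine_row A p i \<xi> * affine_row A p i \<eta> \<Longrightarrow>
          (0 < A $ i $ j \<longrightarrow> \<eta> $ i / \<xi> $ i = \<eta> $ j / \<xi> $ j) \<and>
          (0 < p $ i \<longrightarrow> \<eta> $ i / \<xi> $ i = 1)" (is "?eq \<Longrightarrow> ?concl")
proof -
  define w where "w x = (case x of None \<Rightarrow> p $ i | Some j \<Rightarrow> A $ i $ j)" for x
  define u where "u x = (case x of None \<Rightarrow> 1 | Some j \<Rightarrow> sqrt (\<xi> $ j))" for x
  define v where "v x = (case x of None \<Rightarrow> 1 | Some j \<Rightarrow> sqrt (\<eta> $ j))" for x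
  have w: "0 \<le> w x" for x using A_nonneg p_nonneg by (simp add: w_def split: option.split)
  have rows: "affine_row A p i \<xi> = (\<Sum>x\<in>UNIV. w x * (u x)\<^sup>2)"
    "affine_row A p i \<eta> = (\<Sum>x\<in>UNIV. w x * (v x)\<^sup>2)"
    "affine_row A p i \<zeta> = (\<Sum>x\<in>UNIV. w x * (u x * v x))"
    unfolding affine_row_option w_def u_def v_def \<zeta>_def
    using less_imp_le[OF \<xi>] less_imp_le[OF \<eta>]
    by (auto intro!: sum.cong simp: real_sqrt_mult split: option.split)
  show ?le unfolding rows by (rule weighted_Cauchy_Schwarz) (use w in auto)
  assume ?eq
  then have CS: "u x * v y = u y * v x" if "0 < w x" "0 < w y" for x y
    unfolding rows by (rule weighted_Cauchy_Schwarz_eqD[rotated 2]) (use w that in auto)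
  \<comment> \<open>The positive diagonal puts \<open>i\<close> itself into the support, so
    coordinate \<open>i\<close> can be compared with each neighbour and with the constant
    coordinate.\<close>
  have wi: "0 < w (Some i)" by (simp add: w_def A_diag)
  show ?concl
  proof (intro conjI impI)
    assume "0 < A $ i $ j"
    then have "sqrt (\<xi> $ j) * sqrt (\<eta> $ i) = sqrt (\<xi> $ i) * sqrt (\<eta> $ j)"
      using CS[of "Some j" "Some i"] wi by (simp add: w_def u_def v_def)
    then have "\<xi> $ j * \<eta> $ i = \<xi> $ i * \<eta> $ j" by (simp flip: real_sqrt_mult)
    with \<xi>[of i] \<xi>[of j] show "\<eta> $ i / \<xi> $ i = \<eta> $ j / \<xi> $ j" by (simp add: field_simps)
  next
    assume "0 < p $ i"
    then have "sqrt (\<eta> $ i) = sqrt (\<xi> $ i)"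
      using CS[of None "Some i"] wi by (simp add: w_def u_def v_def)
    with \<xi>[of i] show "\<eta> $ i / \<xi> $ i = 1" by simp
  qed
qed

lemma unique_minimum_point:
  assumes no: "\<nexists>R. blocking_set A p R"
    and \<xi>: "is_arg_min (E A p) (feasible \<gamma>) \<xi>" and \<eta>: "is_arg_min (E A p) (feasible \<gamma>) \<eta>"
  shows "\<eta> = \<xi>"
proof (rule ccontr)
  assume "\<eta> \<noteq> \<xi>"
  have f: "feasible \<gamma> \<xi>" "feasible \<gamma> \<eta>" using \<xi> \<eta> by (auto simp: is_arg_min_def)
  then have pos: "0 < \<xi> $ i" "0 < \<eta> $ i" for i by (auto simp: feasible_def)
  have prods: "(\<Prod>i\<in>UNIV. \<xi> $ i) = exp \<gamma>" "(\<Prod>i\<in>UNIV. \<eta> $ i) = exp \<gamma>"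
    using f by (auto simp: feasible_def)
  \<comment> \<open>The midpoint in logarithmic coordinates, which stays on the constraint
    hyperplane.\<close>
  define \<zeta> :: "real ^ 'n" where "\<zeta> = (\<chi> i. sqrt (\<xi> $ i * \<eta> $ i))"
  have \<zeta>pos: "0 < \<zeta> $ i" for i using pos by (simp add: \<zeta>_def)
  have "(\<Prod>i\<in>UNIV. \<zeta> $ i)\<^sup>2 = (\<Prod>i\<in>UNIV. \<xi> $ i * \<eta> $ i)"
    unfolding prod_power_distrib using pos by (intro prod.cong) (simp_all add: \<zeta>_def less_imp_le)
  also have "\<dots> = (exp \<gamma>)\<^sup>2" by (simp add: prod.distrib prods power2_eq_square)
  finally have "(\<Prod>i\<in>UNIV. \<zeta> $ i) = exp \<gamma>"
    by (rule power2_eq_imp_eq) (auto intro: prod_nonneg less_imp_le \<zeta>pos)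
  with \<zeta>pos have f\<zeta>: "feasible \<gamma> \<zeta>" by (simp add: feasible_def)
  let ?r = "affine_row A p"
  have le: "(\<Prod>i\<in>UNIV. ?r i \<xi>) \<le> (\<Prod>i\<in>UNIV. ?r i \<zeta>)"
    "(\<Prod>i\<in>UNIV. ?r i \<eta>) \<le> (\<Prod>i\<in>UNIV. ?r i \<zeta>)"
    using \<xi> \<eta> f\<zeta> E_eq_feasible[OF f(1), of A p] E_eq_feasible[OF f(2), of A p]
      E_eq_feasible[OF f\<zeta>, of A p]
    by (fastforce simp: is_arg_min_def not_less divide_le_cancel)+
  have "(\<Prod>i\<in>UNIV. ?r i \<xi> * ?r i \<eta>) \<le> (\<Prod>i\<in>UNIV. ?r i \<zeta>) * (\<Prod>i\<in>UNIV. ?r i \<zeta>)"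
    unfolding prod.distrib
    using le by (intro mult_mono) (auto intro!: prod_pos less_imp_le affine_row_pos pos \<zeta>pos)
  also have "\<dots> = (\<Prod>i\<in>UNIV. (?r i \<zeta>)\<^sup>2)" by (simp add: power2_eq_square prod.distrib)
  finally have ge: "(\<Prod>i\<in>UNIV. ?r i \<xi> * ?r i \<eta>) \<le> (\<Prod>i\<in>UNIV. (?r i \<zeta>)\<^sup>2)" .
  \<comment> \<open>A single strict row would make the product inequality strict, against minimality
    of both points.\<close>
  have eq: "(?r i \<zeta>)\<^sup>2 = ?r i \<xi> * ?r i \<eta>" for i
  proof (rule ccontr)
    assume "(?r i \<zeta>)\<^sup>2 \<noteq> ?r i \<xi> * ?r i \<eta>"
    then have "(?r i \<zeta>)\<^sup>2 < ?r i \<xi> * ?r i \<eta>"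
      using affine_row_geometric_mean(1)[OF pos(1) pos(2), of i] by (simp add: \<zeta>_def)
    then have "(\<Prod>i\<in>UNIV. (?r i \<zeta>)\<^sup>2) < (\<Prod>i\<in>UNIV. ?r i \<xi> * ?r i \<eta>)"
      using affine_row_geometric_mean(1)[OF pos(1) pos(2)]
      by (intro prod_mono_strict) (auto simp: \<zeta>_def intro!: mult_pos_pos affine_row_pos pos)
    with ge show False by simp
  qed
  define t where "t i = \<eta> $ i / \<xi> $ i" for i
  have t_pos: "0 < t i" for i using pos by (simp add: t_def)
  have t_prod: "(\<Prod>i\<in>UNIV. t i) = 1" by (simp add: t_def prod_dividef prods)
  have t_edge: "t i = t j" if "0 < A $ i $ j" for i j
    using affine_row_geometric_mean(2)[OF pos(1) pos(2) eq[unfolded \<zeta>_def], of i j] that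
    by (simp add: t_def)
  have t_p: "t i = 1" if "0 < p $ i" for i
    using affine_row_geometric_mean(2)[OF pos(1) pos(2) eq[unfolded \<zeta>_def], of i i] that
    by (simp add: t_def)
  define m where "m = Min (range t)"
  have m_le: "m \<le> t i" for i by (simp add: m_def)
  have "m \<in> range t" unfolding m_def by (rule Min_in) auto
  obtain i1 where "\<eta> $ i1 \<noteq> \<xi> $ i1" using \<open>\<eta> \<noteq> \<xi>\<close> by (auto simp: vec_eq_iff)
  then have i1: "t i1 \<noteq> 1" using pos(1)[of i1] by (simp add: t_def)
  \<comment> \<open>If all ratios were at least 1, their product being 1 would force each to equal
    1.\<close>
  have "m < 1"
  proof (rule ccontr)
    assume "\<not> m < 1"
    then have t1: "1 \<le> t i" for i using m_le[of i] by simp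
    with le_prod_of_ge_1[of UNIV i1 t] t_prod have "t i1 \<le> 1" by simp
    with t1[of i1] i1 show False by simp
  qed
  let ?R = "{i. t i = m}"
  have "blocking_set A p ?R"
    unfolding blocking_set_def
  proof (intro conjI ballI allI impI)
    show "?R \<noteq> {}" using \<open>m \<in> range t\<close> by auto
    show "?R \<noteq> UNIV"
    proof
      assume "?R = UNIV"
      then have "t i = m" for i by blast
      \<comment> \<open>The inequality is strict at every index, so the arbitrary
        \<open>undefined\<close> serves as the strict one.\<close>
      then have "(\<Prod>i\<in>UNIV. t i) < (\<Prod>i\<in>(UNIV :: 'n set). 1)"
        using \<open>m < 1\<close> t_pos by (intro prod_mono_strict[of undefined]) (auto intro: less_imp_le)
      with t_prod show False by simp
    qed
    show "p $ i = 0" if "i \<in> ?R" for i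
      using that t_p[of i] \<open>m < 1\<close> p_nonneg[of i] by fastforce
    show "j \<in> ?R" if "i \<in> ?R" "0 < A $ i $ j" for i j using that t_edge[of i j] by simp
  qed
  with no show False by blast
qed

subsection \<open>Existence\<close>

text \<open>The quotients of row by coordinate and diagonal entry are all at least 1, so each is
  bounded by their product, which is \<open>E\<close> divided by the product of the
  diagonal.\<close>

lemma sublevel_affine_row_bound:
  assumes "0 < C"
  shows "\<exists>K>0. \<forall>\<eta> i. (\<forall>k. 0 < \<eta> $ k) \<longrightarrow> E A p \<eta> \<le> C \<longrightarrow> affine_row A p i \<eta> \<le> K * \<eta> $ i"
proof (intro exI conjI allI impI)
  define D where "D = (\<Prod>i\<in>UNIV. A $ i $ i)"
  \<comment> \<open>The trace dominates every diagonal entry and so makes the constant independent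
    of \<open>i\<close>.\<close>
  define T where "T = (\<Sum>i\<in>UNIV. A $ i $ i)"
  have "0 < D" unfolding D_def by (rule prod_pos) (simp add: A_diag)
  have "0 < T" unfolding T_def by (rule sum_pos) (auto simp: A_diag)
  show "0 < T * (C / D)" using \<open>0 < D\<close> \<open>0 < T\<close> assms by simp
  fix \<eta> :: "real ^ 'n" and i
  assume "\<forall>k. 0 < \<eta> $ k" and le: "E A p \<eta> \<le> C"
  then have pos: "0 < \<eta> $ k" for k by blast
  let ?f = "\<lambda>k. affine_row A p k \<eta> / \<eta> $ k / A $ k $ k"
  have "1 \<le> ?f k" for k
    using entry_le_affine_row[OF pos, of k k] pos[of k] A_diag[of k] by (simp add: field_simps)
  then have "?f i \<le> (\<Prod>k\<in>UNIV. ?f k)" by (intro le_prod_of_ge_1) auto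
  also have "\<dots> = E A p \<eta> / D" by (simp only: E_eq D_def prod_dividef)
  also have "\<dots> \<le> C / D" using le \<open>0 < D\<close> by (simp add: divide_right_mono)
  finally have "affine_row A p i \<eta> \<le> A $ i $ i * (C / D) * \<eta> $ i"
    using pos[of i] A_diag[of i] by (simp add: pos_divide_le_eq mult_ac)
  also have "A $ i $ i \<le> T"
    unfolding T_def by (rule member_le_sum) (auto simp: A_nonneg)
  then have "A $ i $ i * (C / D) * \<eta> $ i \<le> T * (C / D) * \<eta> $ i"
    using assms \<open>0 < D\<close> pos[of i] by (intro mult_right_mono) auto
  finally show "affine_row A p i \<eta> \<le> T * (C / D) * \<eta> $ i" .
qed

text \<open>An edge from \<open>y\<close> to \<open>z\<close> bounds coordinate \<open>z\<close> by
  a multiple of coordinate \<open>y\<close> through row \<open>y\<close>; these constants multiply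
  along a walk and do not depend on \<eta>.\<close>

lemma ratio_bound:
  assumes "0 < K" "(i, j) \<in> (positive_graph A)\<^sup>*"
  shows "\<exists>c>0. \<forall>\<eta>. (\<forall>k. 0 < \<eta> $ k) \<longrightarrow> (\<forall>k. affine_row A p k \<eta> \<le> K * \<eta> $ k)
    \<longrightarrow> \<eta> $ j \<le> c * \<eta> $ i"
  using assms(2)
proof (induction rule: rtrancl_induct)
  case base
  show ?case by (rule exI[of _ 1]) simp
next
  case (step y z)
  then obtain c where c: "0 < c" "\<And>\<eta>. \<lbrakk>\<forall>k. 0 < \<eta> $ k; \<forall>k. affine_row A p k \<eta> \<le> K * \<eta> $ k\<rbrakk>
    \<Longrightarrow> \<eta> $ y \<le> c * \<eta> $ i" by blast
  have Ayz: "0 < A $ y $ z" using step.hyps(2) by (simp add: positive_graph_def)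
  show ?case
  proof (intro exI conjI allI impI)
    show "0 < K * c / A $ y $ z" using c(1) Ayz \<open>0 < K\<close> by simp
    fix \<eta> :: "real ^ 'n"
    assume pos: "\<forall>k. 0 < \<eta> $ k" and row: "\<forall>k. affine_row A p k \<eta> \<le> K * \<eta> $ k"
    have "A $ y $ z * \<eta> $ z \<le> affine_row A p y \<eta>" using entry_le_affine_row pos by blast
    also have "\<dots> \<le> K * \<eta> $ y" using row by blast
    also have "\<dots> \<le> K * (c * \<eta> $ i)" using c(2)[OF pos row] \<open>0 < K\<close> by simp
    finally show "\<eta> $ z \<le> K * c / A $ y $ z * \<eta> $ i"
      using Ayz by (simp add: field_simps)
  qed
qed

text \<open>If \<open>i\<close> leads to some \<open>k\<close> with positive \<open>p $ k\<close>,
  that entry bounds row \<open>k\<close>, hence coordinate \<open>k\<close> and then coordinate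
  \<open>i\<close>, from below. Otherwise \<open>i\<close> reaches every index, so all coordinates
  are bounded by multiples of coordinate \<open>i\<close>, and the fixed product keeps it away from
  0.\<close>

lemma coordinate_lower_bound:
  assumes no: "\<nexists>R. blocking_set A p R" and "0 < K"
  shows "\<exists>\<kappa>>0. \<forall>\<eta>. feasible \<gamma> \<eta> \<longrightarrow> (\<forall>k. affine_row A p k \<eta> \<le> K * \<eta> $ k) \<longrightarrow> \<kappa> \<le> \<eta> $ i"
proof (cases "\<exists>k. (i, k) \<in> (positive_graph A)\<^sup>* \<and> 0 < p $ k")
  case True
  then obtain k where k: "(i, k) \<in> (positive_graph A)\<^sup>*" "0 < p $ k" by blast
  from ratio_bound[OF \<open>0 < K\<close> k(1)] obtain c where c: "0 < c"
    "\<And>\<eta>. \<lbrakk>\<forall>k. 0 < \<eta> $ k; \<forall>k. affine_row A p k \<eta> \<le> K * \<eta> $ k\<rbrakk> \<Longrightarrow> \<eta> $ k \<le> c * \<eta> $ i" by blast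
  show ?thesis
  proof (intro exI conjI allI impI)
    show "0 < p $ k / (K * c)" using k(2) c(1) \<open>0 < K\<close> by simp
    fix \<eta> :: "real ^ 'n"
    assume "feasible \<gamma> \<eta>" and row: "\<forall>k. affine_row A p k \<eta> \<le> K * \<eta> $ k"
    then have pos: "\<forall>k. 0 < \<eta> $ k" by (simp add: feasible_def)
    then have "p $ k \<le> affine_row A p k \<eta>" using inhomogeneity_le_affine_row by blast
    also have "\<dots> \<le> K * \<eta> $ k" using row by blast
    also have "\<dots> \<le> K * (c * \<eta> $ i)" using c(2)[OF pos row] \<open>0 < K\<close> by simp
    finally show "p $ k / (K * c) \<le> \<eta> $ i"
      using c(1) \<open>0 < K\<close> by (simp add: pos_divide_le_eq mult_ac)
  qed
next
  case False
  let ?R = "(positive_graph A)\<^sup>* `` {i}"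
  have "p $ k = 0" if "k \<in> ?R" for k
    using that False p_nonneg[of k] by (metis Image_singleton_iff order_le_less)
  moreover have "l \<in> ?R" if "k \<in> ?R" "0 < A $ k $ l" for k l
    using that by (auto simp: positive_graph_def intro: rtrancl_into_rtrancl)
  moreover have "i \<in> ?R" by simp
  ultimately have "blocking_set A p ?R" if "?R \<noteq> UNIV"
    unfolding blocking_set_def using that by (metis empty_iff)
  with no have "?R = UNIV" by blast
  then have "\<exists>c>0. \<forall>\<eta>. (\<forall>k. 0 < \<eta> $ k) \<longrightarrow> (\<forall>k. affine_row A p k \<eta> \<le> K * \<eta> $ k)
    \<longrightarrow> \<eta> $ j \<le> c * \<eta> $ i" for j
    using ratio_bound[OF \<open>0 < K\<close>, of i j] by blast
  then obtain c where c: "\<And>j. 0 < c j"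
    "\<And>j \<eta>. \<lbrakk>\<forall>k. 0 < \<eta> $ k; \<forall>k. affine_row A p k \<eta> \<le> K * \<eta> $ k\<rbrakk> \<Longrightarrow> \<eta> $ j \<le> c j * \<eta> $ i"
    by metis
  define P where "P = (\<Prod>j\<in>UNIV. c j)"
  have "0 < P" unfolding P_def by (rule prod_pos) (simp add: c(1))
  \<comment> \<open>The positive solution of
    \<open>P * \<kappa> ^ CARD('n) = exp \<gamma>\<close>.\<close>
  define \<kappa> where "\<kappa> = root CARD('n) (exp \<gamma> / P)"
  show ?thesis
  proof (intro exI conjI allI impI)
    show "0 < \<kappa>" using \<open>0 < P\<close> by (simp add: \<kappa>_def)
    fix \<eta> :: "real ^ 'n"
    assume f: "feasible \<gamma> \<eta>" and row: "\<forall>k. affine_row A p k \<eta> \<le> K * \<eta> $ k"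
    then have pos: "\<forall>k. 0 < \<eta> $ k" by (simp add: feasible_def)
    have "exp \<gamma> = (\<Prod>j\<in>UNIV. \<eta> $ j)" using f by (simp add: feasible_def)
    also have "\<dots> \<le> (\<Prod>j\<in>UNIV. c j * \<eta> $ i)"
      using c(2)[OF pos row] pos by (intro prod_mono) (auto intro: less_imp_le)
    also have "\<dots> = P * (\<eta> $ i) ^ CARD('n)" by (simp add: prod.distrib P_def)
    finally have "exp \<gamma> / P \<le> (\<eta> $ i) ^ CARD('n)"
      using \<open>0 < P\<close> by (simp add: pos_divide_le_eq mult_ac)
    then have "\<kappa> \<le> root CARD('n) ((\<eta> $ i) ^ CARD('n))" unfolding \<kappa>_def by simp
    also have "\<dots> = \<eta> $ i" using pos by (simp add: real_root_power_cancel less_imp_le)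
    finally show "\<kappa> \<le> \<eta> $ i" .
  qed
qed

lemma ex_minimum_point:
  assumes no: "\<nexists>R. blocking_set A p R"
  shows "\<exists>\<xi>. is_arg_min (E A p) (feasible \<gamma>) \<xi>"
proof -
  \<comment> \<open>The constant feasible vector; its value fixes the sublevel set to be shown
    bounded.\<close>
  define e :: "real ^ 'n" where "e = (\<chi> i. exp (\<gamma> / CARD('n)))"
  have e: "feasible \<gamma> e" by (simp add: feasible_def e_def flip: exp_of_nat_mult)
  define C where "C = E A p e"
  have "0 < C"
    unfolding C_def E_eq_feasible[OF e]
    using e by (auto simp: feasible_def intro!: divide_pos_pos prod_pos affine_row_pos)
  from sublevel_affine_row_bound[OF this] obtain K where K: "0 < K"
    "\<And>\<eta> i. \<lbrakk>\<forall>k. 0 < \<eta> $ k; E A p \<eta> \<le> C\<rbrakk> \<Longrightarrow> affine_row A p i \<eta> \<le> K * \<eta> $ i" by blast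
  from coordinate_lower_bound[OF no K(1), of \<gamma>] obtain \<kappa>' where \<kappa>': "\<And>i. 0 < \<kappa>' i"
    "\<And>i \<eta>. \<lbrakk>feasible \<gamma> \<eta>; \<forall>k. affine_row A p k \<eta> \<le> K * \<eta> $ k\<rbrakk> \<Longrightarrow> \<kappa>' i \<le> \<eta> $ i"
    by metis
  define \<kappa> where "\<kappa> = Min (range \<kappa>')"
  have "0 < \<kappa>" using \<kappa>'(1) by (simp add: \<kappa>_def)
  have lower: "\<kappa> \<le> \<eta> $ i" if "feasible \<gamma> \<eta>" "E A p \<eta> \<le> C" for \<eta> i
  proof -
    have "\<kappa> \<le> \<kappa>' i" by (simp add: \<kappa>_def)
    also have "\<dots> \<le> \<eta> $ i" using that K(2) by (intro \<kappa>'(2)) (auto simp: feasible_def)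
    finally show ?thesis .
  qed
  \<comment> \<open>After division by \<kappa> all coordinates are at least 1, so each is at most
    their product.\<close>
  define U where "U = exp \<gamma> / \<kappa> ^ CARD('n) * \<kappa>"
  have upper: "\<eta> $ i \<le> U" if "feasible \<gamma> \<eta>" "E A p \<eta> \<le> C" for \<eta> i
  proof -
    have "\<eta> $ i / \<kappa> \<le> (\<Prod>j\<in>UNIV. \<eta> $ j / \<kappa>)"
      using lower[OF that] \<open>0 < \<kappa>\<close> by (intro le_prod_of_ge_1) auto
    also have "\<dots> = exp \<gamma> / \<kappa> ^ CARD('n)" using that(1) by (simp add: prod_dividef feasible_def)
    finally show ?thesis using \<open>0 < \<kappa>\<close> by (simp add: U_def pos_divide_le_eq)
  qed
  \<comment> \<open>A compact set of feasible points containing the sublevel set; the lower bound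
    keeps it away from the poles of \<open>E\<close>.\<close>
  define S :: "(real ^ 'n) set" where
    "S = cbox (\<chi> i. \<kappa>) (\<chi> i. U) \<inter> {\<eta>. (\<Prod>i\<in>UNIV. \<eta> $ i) = exp \<gamma>}"
  have S_pos: "0 < \<eta> $ i" if "\<eta> \<in> S" for \<eta> i
  proof -
    from that have "\<kappa> \<le> \<eta> $ i" by (simp add: S_def mem_box_cart)
    with \<open>0 < \<kappa>\<close> show ?thesis by linarith
  qed
  have in_S: "\<eta> \<in> S" if "feasible \<gamma> \<eta>" "E A p \<eta> \<le> C" for \<eta>
    using lower[OF that] upper[OF that] that(1) by (simp add: S_def mem_box_cart feasible_def)
  have "closed {\<eta> :: real ^ 'n. (\<Prod>i\<in>UNIV. \<eta> $ i) = exp \<gamma>}"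
    by (intro closed_Collect_eq continuous_intros)
  then have "compact S" unfolding S_def by (intro compact_Int_closed compact_cbox)
  moreover have "S \<noteq> {}" using in_S[OF e] by (auto simp: C_def)
  moreover have "continuous_on S (E A p)"
    unfolding E_def
    by (intro continuous_intros) (metis S_pos less_irrefl)
  ultimately obtain \<xi> where \<xi>: "\<xi> \<in> S" "\<And>\<eta>. \<eta> \<in> S \<Longrightarrow> E A p \<xi> \<le> E A p \<eta>"
    using continuous_attains_inf[of S "E A p"] by blast
  have "feasible \<gamma> \<xi>" using \<xi>(1) S_pos by (simp add: feasible_def S_def)
  \<comment> \<open>Feasible points outside the sublevel set are worse than \<open>e\<close>, which
    lies in \<open>S\<close>.\<close>
  moreover have "E A p \<xi> \<le> E A p \<eta>" if "feasible \<gamma> \<eta>" for \<eta>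
  proof (cases "E A p \<eta> \<le> C")
    case True
    with that show ?thesis by (intro \<xi>(2) in_S)
  next
    case False
    moreover have "E A p \<xi> \<le> C" unfolding C_def using in_S[OF e] by (intro \<xi>(2)) (simp add: C_def)
    ultimately show ?thesis by linarith
  qed
  ultimately have "is_arg_min (E A p) (feasible \<gamma>) \<xi>"
    by (fastforce simp: is_arg_min_def not_less)
  then show ?thesis ..
qed

section \<open>Unique solvability in terms of blocking sets\<close>

lemma ex1_minimum_point_iff:
  "(\<exists>!\<xi>. is_arg_min (E A p) (feasible \<gamma>) \<xi>) \<longleftrightarrow> (\<nexists>R. blocking_set A p R)"
proof
  assume "\<exists>!\<xi>. is_arg_min (E A p) (feasible \<gamma>) \<xi>"
  then obtain \<xi> where \<xi>: "is_arg_min (E A p) (feasible \<gamma>) \<xi>"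
    and unique: "\<And>\<eta>. is_arg_min (E A p) (feasible \<gamma>) \<eta> \<Longrightarrow> \<eta> = \<xi>" by blast
  show "\<nexists>R. blocking_set A p R"
  proof
    assume "\<exists>R. blocking_set A p R"
    then obtain \<eta> where \<eta>: "feasible \<gamma> \<eta>" "\<eta> \<noteq> \<xi>" "E A p \<eta> \<le> E A p \<xi>"
      using blocking_set_not_unique \<xi> unfolding is_arg_min_def by blast
    \<comment> \<open>A feasible point whose value does not exceed the minimum is itself a minimum
      point.\<close>
    then have "is_arg_min (E A p) (feasible \<gamma>) \<eta>" using \<xi> by (blast intro: is_arg_min_antimono)
    with unique \<eta>(2) show False by blast
  qed
next
  assume "\<nexists>R. blocking_set A p R"
  then show "\<exists>!\<xi>. is_arg_min (E A p) (feasible \<gamma>) \<xi>"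
    using ex_minimum_point unique_minimum_point by blast
qed

end

theorem theoremV2:
  fixes \<gamma> :: real and A :: "real ^ 'n ^ 'n" and p :: "real ^ 'n"
  assumes "\<And>i j. A $ i $ j \<ge> 0"
    and "\<And>i. A $ i $ i > 0"
    and "\<And>i. p $ i \<ge> 0"
  shows "(\<exists>!\<xi>. is_arg_min (E A p) (\<lambda>\<xi>. (\<forall>i. \<xi> $ i > 0) \<and> exp \<gamma> = (\<Prod>i\<in>UNIV. \<xi> $ i)) \<xi>)
    \<longleftrightarrow> irreducible_matrix A \<or> irreducible_matrix (bordered_matrix A p)"
proof -
  interpret positive_diagonal_system A p by unfold_locales (fact assms)+
  show ?thesis
    using ex1_minimum_point_iff[of \<gamma>] irreducible_iff_no_blocking_set[of p A] assms(3)
    unfolding feasible_def by simp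
qed

end
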